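(* Let $\mathbb{H}^2$ be the real hyperbolic plane, let $T_3$ be the infinite $3$-regular tree, and let $Z$ be a bounded degree graph with subexponential growth. Then there is no quasi-isometric embedding $\mathbb{H}^2\to T_3\times Z$.
   Context: Graphs carry their shortest path metric and $T_3\times Z$ a product metric (e.g. $\ell^1$). A bounded degree graph $Z$ has subexponential growth if $\lim_{r\to\infty}\frac1r\log|B(z,r)|=0$ for a (any) vertex $z$. *)

theory Defs
  imports "HOL-Analysis.Analysis"
begin

definition simple_graph :: "'a set \<Rightarrow> ('a \<Rightarrow> 'a \<Rightarrow> bool) \<Rightarrow> bool" where
  "simple_graph V E \<longleftrightarrow> (\<forall>x y. E x y \<longrightarrow> E y x) \<and> (\<forall>x. \<not> E x x)
     \<and> (\<forall>x y. E x y \<longrightarrow> x \<in> V \<and> y \<in> V)"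

definition walk :: "'a set \<Rightarrow> ('a \<Rightarrow> 'a \<Rightarrow> bool) \<Rightarrow> 'a list \<Rightarrow> bool" where
  "walk V E p \<longleftrightarrow> p \<noteq> [] \<and> set p \<subseteq> V \<and> (\<forall>i. Suc i < length p \<longrightarrow> E (p ! i) (p ! Suc i))"

definition connected_graph :: "'a set \<Rightarrow> ('a \<Rightarrow> 'a \<Rightarrow> bool) \<Rightarrow> bool" where
  "connected_graph V E \<longleftrightarrow> (\<forall>x\<in>V. \<forall>y\<in>V. \<exists>p. walk V E p \<and> hd p = x \<and> last p = y)"

text \<open>Shortest path distance (number of edges of a shortest walk); meaningful for connected graphs.\<close>
definition graph_dist :: "'a set \<Rightarrow> ('a \<Rightarrow> 'a \<Rightarrow> bool) \<Rightarrow> 'a \<Rightarrow> 'a \<Rightarrow> nat" where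
  "graph_dist V E x y = (LEAST n. \<exists>p. walk V E p \<and> hd p = x \<and> last p = y \<and> length p = Suc n)"

definition bounded_degree :: "'a set \<Rightarrow> ('a \<Rightarrow> 'a \<Rightarrow> bool) \<Rightarrow> bool" where
  "bounded_degree V E \<longleftrightarrow> (\<exists>D::nat. \<forall>v\<in>V. finite {w\<in>V. E v w} \<and> card {w\<in>V. E v w} \<le> D)"

definition graph_ball :: "'a set \<Rightarrow> ('a \<Rightarrow> 'a \<Rightarrow> bool) \<Rightarrow> 'a \<Rightarrow> nat \<Rightarrow> 'a set" where
  "graph_ball V E z r = {w\<in>V. graph_dist V E z w \<le> r}"

definition subexp_growth :: "'a set \<Rightarrow> ('a \<Rightarrow> 'a \<Rightarrow> bool) \<Rightarrow> bool" where
  "subexp_growth V E \<longleftrightarrow> (\<exists>z\<in>V.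
     (\<lambda>r::nat. ln (real (card (graph_ball V E z r))) / real r) \<longlonglongrightarrow> 0)"

text \<open>Cayley graph of Z/2 * Z/2 * Z/2: vertices are reduced words over {0,1,2}
  (no two consecutive letters equal), edges join w and w@[a].\<close>

definition T3_verts :: "nat list set" where
  "T3_verts = {xs. set xs \<subseteq> {0,1,2} \<and> (\<forall>i. Suc i < length xs \<longrightarrow> xs ! i \<noteq> xs ! Suc i)}"

definition T3_edge :: "nat list \<Rightarrow> nat list \<Rightarrow> bool" where
  "T3_edge xs ys \<longleftrightarrow> xs \<in> T3_verts \<and> ys \<in> T3_verts \<and> (\<exists>a. ys = xs @ [a] \<or> xs = ys @ [a])"

definition H2 :: "complex set" where
  "H2 = {z. Im z > 0}"

definition hyp_dist :: "complex \<Rightarrow> complex \<Rightarrow> real" where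
  "hyp_dist z w = arcosh (1 + (cmod (z - w))\<^sup>2 / (2 * Im z * Im w))"

definition qi_embedding ::
  "'a set \<Rightarrow> ('a \<Rightarrow> 'a \<Rightarrow> real) \<Rightarrow> 'b set \<Rightarrow> ('b \<Rightarrow> 'b \<Rightarrow> real) \<Rightarrow> ('a \<Rightarrow> 'b) \<Rightarrow> bool" where
  "qi_embedding A dA B dB f \<longleftrightarrow> f ` A \<subseteq> B \<and>
     (\<exists>L C. L \<ge> 1 \<and> C \<ge> 0 \<and> (\<forall>x\<in>A. \<forall>y\<in>A.
        dA x y / L - C \<le> dB (f x) (f y) \<and> dB (f x) (f y) \<le> L * dA x y + C))"

definition T3_prod_dist :: "'z set \<Rightarrow> ('z \<Rightarrow> 'z \<Rightarrow> bool) \<Rightarrow> nat list \<times> 'z \<Rightarrow> nat list \<times> 'z \<Rightarrow> real" where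
  "T3_prod_dist V E p q = real (graph_dist T3_verts T3_edge (fst p) (fst q)) + real (graph_dist V E (snd p) (snd q))"

end

theory Submission
  imports Defs "HOL-Library.Sublist"
begin

text \<open>
  Write \<open>f = (a, b)\<close> and work in the upper half plane. All points at height about \<open>2^(-2k)\<close> over the
  unit interval have \<open>a\<close>-values within \<open>O(k)\<close> of the tree vertex \<open>v = a(i)\<close>. Cut the unit interval
  into \<open>2^k\<close> blocks and look at the row at height \<open>2^(-2Kk)\<close>, with \<open>K\<close> a large constant. If the
  row over every block has a point whose \<open>a\<close>-value is \<open>O(k)\<close>-close to \<open>v\<close>, then these \<open>2^k\<close> points
  are so far apart compared with the distances of their \<open>a\<close>-values that \<open>b\<close> must separate them.
  Otherwise the row over some block is mapped outside a ball around \<open>v\<close>, hence, being coarsely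
  connected, into a single branch of the tree; each of exponentially many vertical columns over
  that block must then pass near the vertex where this branch starts, and \<open>b\<close> must separate these
  crossing points. Either way a ball of radius \<open>O(k)\<close> in \<open>Z\<close> contains exponentially many vertices.
\<close>

section \<open>Graph distance\<close>

lemma graph_dist_le:
  assumes "walk V E p" "hd p = x" "last p = y" "length p = Suc n"
  shows "graph_dist V E x y \<le> n"
  unfolding graph_dist_def by (rule Least_le) (use assms in blast)

lemma graph_dist_walk:
  assumes "\<exists>p. walk V E p \<and> hd p = x \<and> last p = y"
  obtains p where "walk V E p" "hd p = x" "last p = y" "length p = Suc (graph_dist V E x y)"
proof -
  obtain p where p: "walk V E p" "hd p = x" "last p = y" using assms by blast
  have "length p = Suc (length p - 1)" using p(1) by (cases p) (auto simp: walk_def)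
  then have "\<exists>n p. walk V E p \<and> hd p = x \<and> last p = y \<and> length p = Suc n" using p by blast
  from LeastI_ex[OF this] show ?thesis using that unfolding graph_dist_def by blast
qed

lemma graph_dist_self: "x \<in> V \<Longrightarrow> graph_dist V E x x = 0"
  using graph_dist_le[of V E "[x]" x x 0] by (simp add: walk_def)

lemma walk_append:
  assumes "walk V E p" "walk V E q" "last p = hd q"
  shows "walk V E (p @ tl q)"
proof -
  have "E ((p @ tl q) ! i) ((p @ tl q) ! Suc i)" if i: "Suc i < length (p @ tl q)" for i
  proof -
    consider "Suc i < length p" | "Suc i = length p" | "Suc i > length p" by linarith
    then show ?thesis
    proof cases
      case 1
      then show ?thesis using assms(1) by (simp add: walk_def nth_append)
    next
      case 2
      then have "p ! i = q ! 0"
        using assms by (metis walk_def diff_Suc_1 hd_conv_nth last_conv_nth)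
      then show ?thesis using 2 i assms(2) by (auto simp: walk_def nth_append nth_tl)
    next
      case 3
      then obtain k where "i = length p + k" by (metis less_Suc_eq_le le_Suc_ex)
      then show ?thesis using i assms(2) by (auto simp: walk_def nth_append nth_tl)
    qed
  qed
  moreover have "set (tl q) \<subseteq> set q" by (cases q) auto
  ultimately show ?thesis using assms unfolding walk_def by auto
qed

lemma graph_dist_triangle:
  assumes "connected_graph V E" "x \<in> V" "y \<in> V" "z \<in> V"
  shows "graph_dist V E x z \<le> graph_dist V E x y + graph_dist V E y z"
proof -
  obtain p where p: "walk V E p" "hd p = x" "last p = y" "length p = Suc (graph_dist V E x y)"
    using graph_dist_walk assms unfolding connected_graph_def by metis
  obtain q where q: "walk V E q" "hd q = y" "last q = z" "length q = Suc (graph_dist V E y z)"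
    using graph_dist_walk assms unfolding connected_graph_def by metis
  have "p \<noteq> []" "q \<noteq> []" using p q by (auto simp: walk_def)
  then have "hd (p @ tl q) = x" "last (p @ tl q) = z"
    using p q by (auto simp: last_append last_tl) (metis last_ConsL list.collapse)
  then show ?thesis
    using graph_dist_le[OF walk_append[OF p(1) q(1)]] p q by simp
qed

text \<open>Induction on the radius: the last but one vertex of a shortest walk to a vertex at
  distance \<open>Suc r\<close> lies in the ball of radius \<open>r\<close> and has finitely many
  neighbours.\<close>

lemma finite_graph_ball:
  assumes "connected_graph V E" "bounded_degree V E" "z \<in> V"
  shows "finite (graph_ball V E z r)"
proof (induction r)
  case 0
  have "w = z" if "w \<in> graph_ball V E z 0" for w
  proof -
    have "w \<in> V" "graph_dist V E z w = 0" using that by (simp_all add: graph_ball_def)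
    moreover from this have "\<exists>p. walk V E p \<and> hd p = z \<and> last p = w"
      using assms unfolding connected_graph_def by blast
    ultimately obtain p where "walk V E p" "hd p = z" "last p = w" "length p = Suc 0"
      by (metis graph_dist_walk)
    then show ?thesis by (cases p) auto
  qed
  then have "graph_ball V E z 0 \<subseteq> {z}" by blast
  then show ?case by (rule finite_subset) simp
next
  case (Suc r)
  have "graph_ball V E z (Suc r) \<subseteq>
      graph_ball V E z r \<union> (\<Union>v\<in>graph_ball V E z r. {w\<in>V. E v w})"
  proof
    fix w assume w: "w \<in> graph_ball V E z (Suc r)"
    then have wV: "w \<in> V" by (simp add: graph_ball_def)
    show "w \<in> graph_ball V E z r \<union> (\<Union>v\<in>graph_ball V E z r. {w\<in>V. E v w})"
    proof (cases "graph_dist V E z w \<le> r")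
      case True
      then show ?thesis using wV by (simp add: graph_ball_def)
    next
      case False
      then have "graph_dist V E z w = Suc r" using w by (simp add: graph_ball_def)
      then obtain p where p: "walk V E p" "hd p = z" "last p = w" "length p = Suc (Suc r)"
        using assms wV graph_dist_walk[of V E z w] unfolding connected_graph_def by metis
      have "walk V E (take (Suc r) p)"
        using p by (auto simp: walk_def dest: in_set_takeD)
      moreover have "last (take (Suc r) p) = p ! r" using p
        by (simp add: take_Suc_conv_app_nth)
      moreover have "hd (take (Suc r) p) = z" using p by simp
      ultimately have "graph_dist V E z (p ! r) \<le> r" using p graph_dist_le by fastforce
      moreover have "p ! r \<in> V" using p by (auto simp: walk_def)
      moreover have "w = p ! Suc r" using p by (metis diff_Suc_1 last_conv_nth length_0_conv nat.distinct(1))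
      then have "E (p ! r) w" using p by (auto simp: walk_def)
      ultimately show ?thesis using wV by (auto simp: graph_ball_def)
    qed
  qed
  moreover have "finite {w\<in>V. E v w}" if "v \<in> graph_ball V E z r" for v
    using that assms(2) by (auto simp: bounded_degree_def graph_ball_def)
  ultimately show ?case using Suc by (meson finite_UN_I finite_UnI finite_subset)
qed

section \<open>The tree\<close>

abbreviation lcp_len :: "'a list \<Rightarrow> 'a list \<Rightarrow> nat" where
  "lcp_len xs ys \<equiv> length (longest_common_prefix xs ys)"

abbreviation T3_dist :: "nat list \<Rightarrow> nat list \<Rightarrow> nat" where
  "T3_dist \<equiv> graph_dist T3_verts T3_edge"

lemma lcp_len_le: "lcp_len xs ys \<le> length xs" "lcp_len xs ys \<le> length ys"
  by (simp_all add: longest_common_prefix_prefix1 longest_common_prefix_prefix2 prefix_length_le)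

lemma lcp_len_ge: "prefix ps xs \<Longrightarrow> prefix ps ys \<Longrightarrow> length ps \<le> lcp_len xs ys"
  by (simp add: longest_common_prefix_max_prefix prefix_length_le)

lemma lcp_len_commute: "lcp_len xs ys = lcp_len ys xs"
  by (intro antisym lcp_len_ge longest_common_prefix_prefix1 longest_common_prefix_prefix2)

text \<open>Both common prefixes are prefixes of \<open>ys\<close>, hence comparable; the shorter
  one is common to \<open>xs\<close> and \<open>zs\<close>.\<close>

lemma lcp_len_ultrametric: "min (lcp_len xs ys) (lcp_len ys zs) \<le> lcp_len xs zs"
proof -
  let ?p = "longest_common_prefix xs ys" and ?q = "longest_common_prefix ys zs"
  have "prefix ?p ?q \<or> prefix ?q ?p"
    using longest_common_prefix_prefix2 longest_common_prefix_prefix1 prefix_same_cases by blast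
  then show ?thesis
  proof
    assume "prefix ?p ?q"
    then have "length ?p \<le> lcp_len xs zs"
      by (meson lcp_len_ge longest_common_prefix_prefix1 longest_common_prefix_prefix2 prefix_order.trans)
    then show ?thesis by simp
  next
    assume "prefix ?q ?p"
    then have "length ?q \<le> lcp_len xs zs"
      by (meson lcp_len_ge longest_common_prefix_prefix1 longest_common_prefix_prefix2 prefix_order.trans)
    then show ?thesis by simp
  qed
qed

lemma lcp_len_snoc: "lcp_len xs ys \<le> lcp_len xs (ys @ [a])" "lcp_len xs (ys @ [a]) \<le> Suc (lcp_len xs ys)"
proof -
  show "lcp_len xs ys \<le> lcp_len xs (ys @ [a])"
    by (meson lcp_len_ge longest_common_prefix_prefix1 longest_common_prefix_prefix2 prefix_prefix)
  let ?q = "longest_common_prefix xs (ys @ [a])"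
  have "length (butlast ?q) \<le> lcp_len xs ys"
  proof (rule lcp_len_ge)
    show "prefix (butlast ?q) xs"
      by (meson longest_common_prefix_prefix1 prefix_order.trans prefixeq_butlast)
    have "prefix ?q (ys @ [a])" by (rule longest_common_prefix_prefix2)
    then show "prefix (butlast ?q) ys"
      by (metis butlast_snoc prefix_order.trans prefix_snoc prefixeq_butlast)
  qed
  then show "lcp_len xs (ys @ [a]) \<le> Suc (lcp_len xs ys)" by simp
qed

lemma T3_verts_take: "xs \<in> T3_verts \<Longrightarrow> take n xs \<in> T3_verts"
  by (auto simp: T3_verts_def dest: in_set_takeD)

text \<open>Appending a letter to the endpoint lengthens it by 1 and does not shorten the common
  prefix; deleting one shortens it by 1 and the common prefix by at most 1. So the sum of the two
  lengths minus twice \<open>lcp_len\<close> grows by at most 1 per edge.\<close>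

lemma T3_walk_length:
  assumes "walk T3_verts T3_edge p"
  shows "length (hd p) + length (last p) < length p + 2 * lcp_len (hd p) (last p)"
  using assms
proof (induction p rule: rev_induct)
  case Nil
  then show ?case by (simp add: walk_def)
next
  case (snoc y p)
  show ?case
  proof (cases "p = []")
    case True
    have "lcp_len y y \<ge> length y" by (rule lcp_len_ge) auto
    then show ?thesis using True by simp
  next
    case False
    have nth: "T3_edge (p ! i) (p ! Suc i)" if "Suc i < length p" for i
    proof -
      have "T3_edge ((p @ [y]) ! i) ((p @ [y]) ! Suc i)"
        using snoc.prems that by (simp add: walk_def)
      then show ?thesis using that by (simp add: nth_append)
    qed
    then have "walk T3_verts T3_edge p" using snoc.prems False by (simp add: walk_def)
    note IH = snoc.IH[OF this]
    have "Suc (length p - 1) < length (p @ [y])" using False by simp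
    then have "T3_edge ((p @ [y]) ! (length p - 1)) ((p @ [y]) ! Suc (length p - 1))"
      using snoc.prems unfolding walk_def by blast
    then have "T3_edge (last p) y" using False by (simp add: nth_append last_conv_nth)
    then obtain a where "y = last p @ [a] \<or> last p = y @ [a]" unfolding T3_edge_def by blast
    then show ?thesis
    proof
      assume "y = last p @ [a]"
      then show ?thesis using IH False lcp_len_snoc(1)[of "hd p" "last p" a] by simp
    next
      assume "last p = y @ [a]"
      then show ?thesis using IH False lcp_len_snoc(2)[of "hd p" y a] by simp
    qed
  qed
qed

text \<open>Delete letters of \<open>x\<close> down to the common prefix, then append the remaining
  letters of \<open>y\<close>. All words on the way are prefixes of \<open>x\<close> or
  \<open>y\<close>, hence reduced. The induction is on the expected distance.\<close>

lemma T3_walk_exists: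
  assumes "x \<in> T3_verts" "y \<in> T3_verts"
  shows "\<exists>p. walk T3_verts T3_edge p \<and> hd p = x \<and> last p = y
     \<and> length p + 2 * lcp_len x y = Suc (length x + length y)"
  using assms
proof (induction "length x + length y - 2 * lcp_len x y" arbitrary: x rule: less_induct)
  case less
  \<comment> \<open>The equation says that the neighbour \<open>x'\<close> is one step closer to
    \<open>y\<close>.\<close>
  have step: ?case if "T3_edge x x'" "x' \<in> T3_verts"
    "length x + 2 * lcp_len x' y = Suc (length x' + 2 * lcp_len x y)" for x'
  proof -
    have "length x' + length y - 2 * lcp_len x' y < length x + length y - 2 * lcp_len x y"
      using that lcp_len_le[of x y] lcp_len_le[of x' y] by linarith
    from less.hyps[OF this that(2) less.prems(2)] obtain p where
      p: "walk T3_verts T3_edge p" "hd p = x'" "last p = y"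
        "length p + 2 * lcp_len x' y = Suc (length x' + length y)" by blast
    have "walk T3_verts T3_edge (x # p)"
      using p that(1) less.prems(1) by (auto simp: walk_def nth_Cons hd_conv_nth split: nat.split)
    moreover have "last (x # p) = y" using p by (simp add: walk_def)
    moreover have "length (x # p) + 2 * lcp_len x y = Suc (length x + length y)"
      using p(4) that(3) by simp
    ultimately show ?thesis by (intro exI[of _ "x # p"]) simp
  qed
  let ?l = "longest_common_prefix x y"
  show ?case
  proof (cases "?l = x")
    case False
    then have lt: "length ?l < length x"
      by (metis longest_common_prefix_prefix1 prefix_order.not_eq_order_implies_strict prefix_length_less)
    then have x: "x = butlast x @ [last x]" by (metis append_butlast_last_id length_0_conv not_less0)
    have bl: "butlast x \<in> T3_verts"
      using T3_verts_take[OF less.prems(1)] by (simp add: butlast_conv_take)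
    have "prefix ?l (butlast x)"
      using x False longest_common_prefix_prefix1[of x y] by (metis prefix_snoc)
    then have "lcp_len x y \<le> lcp_len (butlast x) y"
      by (rule lcp_len_ge) (rule longest_common_prefix_prefix2)
    moreover have "lcp_len (butlast x) y \<le> lcp_len x y"
      using lcp_len_snoc(1)[of y "butlast x" "last x"] x lcp_len_commute by metis
    ultimately have eq: "lcp_len (butlast x) y = lcp_len x y" by simp
    show ?thesis
    proof (rule step[of "butlast x"])
      show "T3_edge x (butlast x)" using less.prems(1) bl x unfolding T3_edge_def by blast
    qed (use bl eq lt in auto)
  next
    case True
    then have "prefix x y" by (metis longest_common_prefix_prefix2)
    then obtain zs where zs: "y = x @ zs" by (auto simp: prefix_def)
    show ?thesis
    proof (cases zs)
      case Nil
      then show ?thesis using zs True less.prems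
        by (intro exI[of _ "[x]"]) (simp add: walk_def)
    next
      case (Cons a as)
      let ?x = "x @ [a]"
      have v: "?x \<in> T3_verts"
        using T3_verts_take[OF less.prems(2), of "Suc (length x)"] zs Cons by simp
      have "prefix ?x y" using zs Cons by simp
      then have "length ?x \<le> lcp_len ?x y" by (intro lcp_len_ge) auto
      then have "lcp_len ?x y = length ?x" using lcp_len_le(1)[of ?x y] by simp
      then show ?thesis
        using v less.prems(1) True by (intro step[of ?x]) (auto simp: T3_edge_def)
    qed
  qed
qed

lemma T3_dist_eq:
  assumes "x \<in> T3_verts" "y \<in> T3_verts"
  shows "real (T3_dist x y) = real (length x) + real (length y) - 2 * real (lcp_len x y)"
proof -
  obtain p where p: "walk T3_verts T3_edge p" "hd p = x" "last p = y"
    "length p + 2 * lcp_len x y = Suc (length x + length y)"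
    using T3_walk_exists[OF assms] by blast
  have len: "length p = Suc (length p - 1)" using p(1) by (cases p) (auto simp: walk_def)
  from graph_dist_le[OF p(1-3) this] have "T3_dist x y \<le> length p - 1" .
  moreover obtain q where q: "walk T3_verts T3_edge q" "hd q = x" "last q = y"
    "length q = Suc (T3_dist x y)"
    using graph_dist_walk p(1-3) by metis
  have "length x + length y \<le> T3_dist x y + 2 * lcp_len x y" using T3_walk_length[OF q(1)] q by simp
  ultimately have "T3_dist x y + 2 * lcp_len x y = length x + length y" using p(4) len by linarith
  then show ?thesis by linarith
qed

section \<open>Gromov products in the tree\<close>

text \<open>In a tree this is the length of the common initial segment of the geodesics from
  \<open>v\<close> to \<open>x\<close> and to \<open>y\<close>. A value of at least
  \<open>\<rho>\<close> puts both points in the same branch beyond distance \<open>\<rho>\<close>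
  from \<open>v\<close>.\<close>

definition gromov :: "nat list \<Rightarrow> nat list \<Rightarrow> nat list \<Rightarrow> real" where
  "gromov v x y = (real (T3_dist v x) + real (T3_dist v y) - real (T3_dist x y)) / 2"

lemma T3_dist_commute: "x \<in> T3_verts \<Longrightarrow> y \<in> T3_verts \<Longrightarrow> T3_dist x y = T3_dist y x"
  using T3_dist_eq[of x y] T3_dist_eq[of y x] lcp_len_commute[of x y] by simp

lemma gromov_commute: "x \<in> T3_verts \<Longrightarrow> y \<in> T3_verts \<Longrightarrow> gromov v x y = gromov v y x"
  by (simp add: gromov_def T3_dist_commute)

lemma gromov_self: "x \<in> T3_verts \<Longrightarrow> gromov v x x = real (T3_dist v x)"
  by (simp add: gromov_def graph_dist_self)

lemma T3_dist_triangle: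
  assumes "x \<in> T3_verts" "y \<in> T3_verts" "z \<in> T3_verts"
  shows "T3_dist x z \<le> T3_dist x y + T3_dist y z"
  using assms T3_walk_exists by (intro graph_dist_triangle) (auto simp: connected_graph_def)

lemma gromov_le:
  assumes "v \<in> T3_verts" "x \<in> T3_verts" "y \<in> T3_verts"
  shows "gromov v x y \<le> real (T3_dist v x)"
  using T3_dist_triangle[OF assms] by (simp add: gromov_def)

text \<open>Among the three values on a triple the two smallest agree; \<open>u\<close> is the form
  used repeatedly. The inequality serves to move the base point from the empty word to an arbitrary
  vertex.\<close>

lemma four_point_ultrametric:
  fixes l :: "'a \<Rightarrow> 'a \<Rightarrow> nat"
  assumes sym: "\<And>a b. l a b = l b a" and ultra: "\<And>a b c. min (l a b) (l b c) \<le> l a c"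
  shows "min (l x y + l v z) (l y z + l v x) \<le> l x z + l v y"
proof -
  have u: "l b c \<le> l a c" if "l a c < l a b" for a b c using ultra[of a b c] that by simp
  show ?thesis
  proof (rule ccontr)
    assume "\<not> ?thesis"
    then have 1: "l x z + l v y < l x y + l v z" and 2: "l x z + l v y < l y z + l v x" by simp_all
    note syms = sym[of x y] sym[of x z] sym[of y z] sym[of v x] sym[of v y] sym[of v z]
    show False
    proof (cases "l x y \<le> l x z")
      case True
      then have "l v y < l v z" using 1 by linarith
      then have "l z y \<le> l v y" by (rule u)
      then have "l x z < l x v" using 2 syms by linarith
      then have "l v z \<le> l x z" by (rule u)
      then have "l v y < l v x" using \<open>l v y < l v z\<close> \<open>l x z < l x v\<close> syms by linarith
      then have "l x y \<le> l v y" by (rule u)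
      then show False using 1 \<open>l v z \<le> l x z\<close> by linarith
    next
      case False
      then have "l y z \<le> l x z" by (intro u) simp
      then have "l v y < l v x" using 2 by linarith
      then have "l x y \<le> l v y" by (rule u)
      then have "l z x < l z v" using 1 syms by linarith
      then have "l v x \<le> l z x" by (rule u)
      then have "l v y < l v z" using \<open>l v y < l v x\<close> \<open>l z x < l z v\<close> syms by linarith
      then have "l z y \<le> l v y" by (rule u)
      then show False using 2 \<open>l v x \<le> l z x\<close> syms by linarith
    qed
  qed
qed

text \<open>By \<open>T3_dist_eq\<close>, \<open>gromov v x y\<close> equals
  \<open>length v + lcp_len x y - lcp_len v x - lcp_len v y\<close>, which turns the claim into the
  four-point inequality.\<close>

lemma gromov_ultrametric:
  assumes "v \<in> T3_verts" "x \<in> T3_verts" "y \<in> T3_verts" "z \<in> T3_verts"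
  shows "min (gromov v x y) (gromov v y z) \<le> gromov v x z"
proof -
  have "min (lcp_len x y + lcp_len v z) (lcp_len y z + lcp_len v x) \<le> lcp_len x z + lcp_len v y"
    by (rule four_point_ultrametric[where l = lcp_len, OF lcp_len_commute lcp_len_ultrametric])
  then consider "real (lcp_len x y) + real (lcp_len v z) \<le> real (lcp_len x z) + real (lcp_len v y)"
    | "real (lcp_len y z) + real (lcp_len v x) \<le> real (lcp_len x z) + real (lcp_len v y)"
    by linarith
  then have "gromov v x y \<le> gromov v x z \<or> gromov v y z \<le> gromov v x z"
    using T3_dist_eq[OF assms(1,2)] T3_dist_eq[OF assms(1,3)]
      T3_dist_eq[OF assms(1,4)] T3_dist_eq[OF assms(2,3)] T3_dist_eq[OF assms(2,4)]
      T3_dist_eq[OF assms(3,4)]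
    by cases (simp_all add: gromov_def)
  then show ?thesis by linarith
qed

text \<open>A coarse path avoiding a ball around \<open>v\<close> stays in one branch of the tree.\<close>
lemma gromov_chain:
  fixes q :: "nat \<Rightarrow> nat list"
  assumes v: "v \<in> T3_verts" and q: "\<And>i. i \<le> n \<Longrightarrow> q i \<in> T3_verts"
    and far: "\<And>i. i \<le> n \<Longrightarrow> \<rho> + \<kappa> \<le> real (T3_dist v (q i))"
    and step: "\<And>i. i < n \<Longrightarrow> real (T3_dist (q i) (q (Suc i))) \<le> \<kappa>"
    and "0 \<le> \<kappa>"
  shows "\<rho> \<le> gromov v (q 0) (q n)"
  using q far step
proof (induction n)
  case 0
  then show ?case using gromov_self[of "q 0" v] \<open>0 \<le> \<kappa>\<close> by fastforce
next
  case (Suc n)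
  have "\<rho> \<le> gromov v (q 0) (q n)" using Suc by simp
  \<comment> \<open>Two points at distance at least \<open>\<rho> + \<kappa>\<close> from
    \<open>v\<close> and at most \<open>\<kappa>\<close> from each other have product at least
    \<open>\<rho> + \<kappa>/2\<close>.\<close>
  moreover have "\<rho> \<le> gromov v (q n) (q (Suc n))"
    using Suc.prems(2)[of n] Suc.prems(2)[of "Suc n"] Suc.prems(3)[of n] \<open>0 \<le> \<kappa>\<close>
    by (simp add: gromov_def)
  moreover have "min (gromov v (q 0) (q n)) (gromov v (q n) (q (Suc n))) \<le> gromov v (q 0) (q (Suc n))"
    using v Suc.prems(1) by (intro gromov_ultrametric) auto
  ultimately show ?case by linarith
qed

text \<open>The point \<open>p i\<close> found here is within \<open>\<kappa>\<close> of the point at distance \<open>\<rho>\<close> from \<open>v\<close> on the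
  geodesic from \<open>v\<close> to \<open>y\<close>.\<close>
lemma gromov_crossing:
  fixes p :: "nat \<Rightarrow> nat list"
  assumes v: "v \<in> T3_verts" and y: "y \<in> T3_verts" and p: "\<And>i. p i \<in> T3_verts"
    and step: "\<And>i. real (T3_dist (p i) (p (Suc i))) \<le> \<kappa>"
    and start: "gromov v (p 0) y < \<rho>" and finish: "\<rho> \<le> gromov v (p n) y"
  obtains i where "i \<le> n" "real (T3_dist v (p i)) \<le> \<rho> + \<kappa>" "\<rho> \<le> gromov v (p i) y"
proof -
  \<comment> \<open>The first index in the branch of \<open>y\<close>; its predecessor
    \<open>j\<close> is still outside.\<close>
  define i where "i = (LEAST i. \<rho> \<le> gromov v (p i) y)"
  have i: "\<rho> \<le> gromov v (p i) y" unfolding i_def using finish by (rule LeastI)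
  have "i \<le> n" unfolding i_def using finish by (rule Least_le)
  obtain j where j: "i = Suc j" using i start by (cases i) auto
  then have "gromov v (p j) y < \<rho>" using not_less_Least[of j "\<lambda>i. \<rho> \<le> gromov v (p i) y"] i_def by fastforce
  moreover have "min (gromov v (p j) (p i)) (gromov v (p i) y) \<le> gromov v (p j) y"
    using v p y by (intro gromov_ultrametric)
  ultimately have "gromov v (p j) (p i) < \<rho>" using i by linarith
  moreover have "gromov v (p j) (p i) \<le> real (T3_dist v (p j))" using v p by (intro gromov_le)
  moreover have "real (T3_dist (p j) (p i)) \<le> \<kappa>" using step j by simp
  \<comment> \<open>The distance from \<open>v\<close> to \<open>p i\<close> is
    \<open>2 * gromov v (p j) (p i)\<close> minus that to \<open>p j\<close> plus the length of the
    jump, hence at most \<open>gromov v (p j) (p i) + \<kappa>\<close>.\<close>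
  ultimately have "real (T3_dist v (p i)) \<le> \<rho> + \<kappa>" unfolding gromov_def by argo
  then show ?thesis using that i \<open>i \<le> n\<close> by blast
qed

section \<open>Distances in the hyperbolic plane\<close>

lemma ln_le_arcosh: "1 \<le> x \<Longrightarrow> ln x \<le> arcosh (x::real)"
  by (simp add: arcosh_real_def) (rule ln_mono, auto)

lemma arcosh_le_ln: "1 \<le> x \<Longrightarrow> arcosh (x::real) \<le> ln (2 * x)"
proof -
  assume x: "1 \<le> x"
  have "sqrt (x^2 - 1) \<le> sqrt (x^2)" by (rule real_sqrt_le_mono) simp
  then have "sqrt (x^2 - 1) \<le> x" using x by simp
  moreover have "0 \<le> sqrt (x^2 - 1)" using x by simp
  ultimately have "ln (x + sqrt (x^2 - 1)) \<le> ln (2 * x)" using x by (intro ln_mono) linarith+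
  then show ?thesis using x by (simp add: arcosh_real_def)
qed

lemma hyp_dist_upper:
  assumes "0 < y" "0 < y'" "(x - x')^2 + (y - y')^2 \<le> (X - 1) * (2 * y * y')"
  shows "hyp_dist (Complex x y) (Complex x' y') \<le> ln (2 * X)"
proof -
  define Q where "Q = ((x - x')^2 + (y - y')^2) / (2 * y * y')"
  have "(cmod (Complex x y - Complex x' y'))\<^sup>2 = (x - x')^2 + (y - y')^2"
    by (simp add: cmod_power2)
  then have e: "hyp_dist (Complex x y) (Complex x' y') = arcosh (1 + Q)"
    by (simp add: hyp_dist_def Q_def)
  have Q0: "0 \<le> Q" using assms by (simp add: Q_def)
  have "Q \<le> X - 1" using assms by (simp add: Q_def pos_divide_le_eq)
  then have "ln (2 * (1 + Q)) \<le> ln (2 * X)" using Q0 by (intro ln_mono) simp_all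
  then show ?thesis using arcosh_le_ln[of "1 + Q"] Q0 e by linarith
qed

text \<open>Drop the vertical part of the Euclidean distance and replace both heights by the upper
  bound \<open>h\<close>.\<close>

lemma hyp_dist_lower:
  assumes "0 < y" "0 < y'" "y \<le> h" "y' \<le> h" "D \<le> \<bar>x - x'\<bar>" "0 < D"
  shows "ln (D^2 / (2 * h^2)) \<le> hyp_dist (Complex x y) (Complex x' y')"
proof -
  define Q where "Q = ((x - x')^2 + (y - y')^2) / (2 * y * y')"
  have "(cmod (Complex x y - Complex x' y'))\<^sup>2 = (x - x')^2 + (y - y')^2"
    by (simp add: cmod_power2)
  then have e: "hyp_dist (Complex x y) (Complex x' y') = arcosh (1 + Q)"
    by (simp add: hyp_dist_def Q_def)
  have "D^2 \<le> (x - x')^2" using assms by (metis abs_le_square_iff abs_of_pos)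
  then have "D^2 \<le> (x - x')^2 + (y - y')^2" by (simp add: add_increasing2)
  moreover have "2 * y * y' \<le> 2 * h^2"
    using mult_mono[of y h y' h] assms by (simp add: power2_eq_square)
  ultimately have "D^2 / (2 * h^2) \<le> Q" unfolding Q_def using assms by (intro frac_le) auto
  moreover have "0 < D^2 / (2 * h^2)" using assms by simp
  ultimately have "ln (D^2 / (2 * h^2)) \<le> ln (1 + Q)" by (intro ln_mono) linarith+
  moreover have "0 \<le> Q" using assms by (simp add: Q_def)
  ultimately show ?thesis using ln_le_arcosh[of "1 + Q"] e by linarith
qed

section \<open>Points at dyadic heights\<close>

text \<open>Logarithmic depth: one unit of \<open>s\<close> has hyperbolic length
  \<open>ln 2\<close>, and a horizontal shift by \<open>1 / 2^s\<close> at depth \<open>s\<close>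
  has bounded hyperbolic length.\<close>

definition pt :: "real \<Rightarrow> nat \<Rightarrow> complex" where
  "pt x s = Complex x (1 / 2^s)"

lemma pt_in_H2: "pt x s \<in> H2"
  by (simp add: pt_def H2_def)

lemma hyp_dist_pt_down: "hyp_dist (pt x s) (pt x (Suc s)) \<le> 2"
proof -
  have "hyp_dist (pt x s) (pt x (Suc s)) \<le> ln (2 * (3/2))"
    unfolding pt_def by (rule hyp_dist_upper) (simp_all add: field_simps power2_eq_square)
  also have "\<dots> \<le> 2" using ln_le_minus_one[of "3::real"] by simp
  finally show ?thesis .
qed

lemma hyp_dist_pt_side: 
  assumes "\<bar>x - x'\<bar> \<le> 1 / 2^s"
  shows "hyp_dist (pt x s) (pt x' s) \<le> 2"
proof -
  have "(x - x')^2 \<le> (1/2^s)^2" using assms by (metis abs_le_square_iff abs_of_nonneg zero_le_divide_1_iff zero_le_numeral zero_le_power)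
  then have "hyp_dist (pt x s) (pt x' s) \<le> ln (2 * (3/2))"
    unfolding pt_def by (intro hyp_dist_upper) (simp_all add: power2_eq_square)
  also have "\<dots> \<le> 2" using ln_le_minus_one[of "3::real"] by simp
  finally show ?thesis .
qed

lemma hyp_dist_pt_base:
  assumes "0 \<le> x" "x \<le> 1"
  shows "hyp_dist (pt 0 0) (pt x s) \<le> real s + 2"
proof -
  define y :: real where "y = 1 / 2^s"
  have y: "0 < y" "y \<le> 1" by (simp_all add: y_def)
  have "x^2 \<le> 1" using assms by (simp add: power_le_one)
  moreover have "(1 - y)^2 \<le> 1" using y by (intro power_le_one) auto
  \<comment> \<open>Here \<open>X = 2^Suc s\<close> in \<open>hyp_dist_upper\<close>; since
    \<open>y \<le> 1\<close>, the value \<open>4 - 2 * y\<close> is at least 2 and dominates both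
    squares.\<close>
  moreover have "(2^Suc s - 1) * (2 * 1 * y) = 4 - 2 * y" by (simp add: y_def field_simps)
  ultimately have "(0 - x)^2 + (1 - y)^2 \<le> (2^Suc s - 1) * (2 * 1 * y)" using y by simp
  from hyp_dist_upper[OF _ y(1) this]
  have "hyp_dist (pt 0 0) (pt x s) \<le> ln (2^(s + 2))" by (simp add: pt_def y_def)
  also have "\<dots> = (real s + 2) * ln 2" by (subst ln_realpow) auto
  also have "\<dots> \<le> (real s + 2) * 1" using ln_le_minus_one[of "2::real"] by (intro mult_left_mono) auto
  finally show ?thesis by simp
qed

lemma half_le_ln2: "1/2 \<le> ln (2::real)"
  using ln2_ge_two_thirds by linarith

text \<open>A horizontal gap of \<open>2^m\<close> units of the height \<open>1 / 2^l\<close> costs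
  about \<open>2 * m * ln 2\<close> for points at or below that height, and \<open>ln 2\<close> is
  at least \<open>1/2\<close>. For \<open>m = 0\<close> the bound is negative.\<close>

lemma hyp_dist_pt_lower:
  assumes "l \<le> s" "l \<le> s'" "2^m / 2^l \<le> \<bar>x - x'\<bar>" 
  shows "real m - 1/2 \<le> hyp_dist (pt x s) (pt x' s')"
proof -
  have "ln ((2^m / 2^l)^2 / (2 * (1 / 2^l)^2)) \<le> hyp_dist (pt x s) (pt x' s')"
    unfolding pt_def using assms by (intro hyp_dist_lower) (simp_all add: field_simps power_increasing)
  moreover have "(2^m / 2^l)^2 / (2 * (1 / 2^l)^2) = (2^m)^2 / (2::real)"
    by (simp add: field_simps power2_eq_square)
  moreover have "ln ((2^m)^2 / (2::real)) = (2 * real m - 1) * ln 2"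
    by (simp add: ln_div ln_realpow algebra_simps)
  moreover have "real m - 1/2 \<le> (2 * real m - 1) * ln 2" if "m > 0"
  proof -
    have "(2 * real m - 1) * (1/2) \<le> (2 * real m - 1) * ln 2"
      using that by (intro mult_left_mono half_le_ln2) simp
    then show ?thesis by (simp add: left_diff_distrib)
  qed
  moreover have "0 \<le> hyp_dist (pt x s) (pt x' s')"
    unfolding hyp_dist_def by (rule arcosh_nonneg_real) (simp add: pt_def)
  ultimately show ?thesis by (cases "m = 0") auto
qed

section \<open>Many separated points with nearby tree coordinates\<close>

text \<open>Used to bring together crossing points of different columns that enter the same
  branch.\<close>

lemma T3_dist_le_of_gromov:
  assumes "real (T3_dist v x) \<le> \<rho> + \<kappa>" "real (T3_dist v y) \<le> \<rho> + \<kappa>" "\<rho> \<le> gromov v x y"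
  shows "real (T3_dist x y) \<le> 2 * \<kappa>"
  using assms by (simp add: gromov_def)

lemma card_ge_pow2:
  assumes "inj_on g {..<(2::nat)^n}" "g ` {..<2^n} \<subseteq> B" "finite B"
  shows "2^n \<le> card B"
  using card_mono[OF assms(3,2)] card_image[OF assms(1)] by simp

lemma qi_embedding_exponential_growth:
  fixes V :: "'z set" and f :: "complex \<Rightarrow> nat list \<times> 'z"
  assumes conn: "connected_graph V E" and deg: "bounded_degree V E" and z: "z \<in> V"
    and f: "qi_embedding H2 hyp_dist (T3_verts \<times> V) (T3_prod_dist V E) f"
  shows "\<exists>M N. 0 < M \<and> (\<forall>e. 2^e \<le> card (graph_ball V E z (M * e + N)))"
proof -
  obtain L C where L: "1 \<le> L" and C: "0 \<le> C"
    and qi: "\<And>x y. x \<in> H2 \<Longrightarrow> y \<in> H2 \<Longrightarrow> hyp_dist x y / L - C \<le> T3_prod_dist V E (f x) (f y)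
       \<and> T3_prod_dist V E (f x) (f y) \<le> L * hyp_dist x y + C"
    using f unfolding qi_embedding_def by blast
  define a where "a x s = fst (f (pt x s))" for x s
  define b where "b x s = snd (f (pt x s))" for x s
  have fH: "f (pt x s) \<in> T3_verts \<times> V" for x s
    using f pt_in_H2 unfolding qi_embedding_def by blast
  have aT: "a x s \<in> T3_verts" for x s using fH[of x s] by (auto simp: a_def)
  have bV: "b x s \<in> V" for x s using fH[of x s] by (auto simp: b_def)
  have prod: "T3_prod_dist V E (f (pt x s)) (f (pt x' s')) =
      real (T3_dist (a x s) (a x' s')) + real (graph_dist V E (b x s) (b x' s'))" for x s x' s'
    by (simp add: T3_prod_dist_def a_def b_def)
  have up: "real (T3_dist (a x s) (a x' s')) + real (graph_dist V E (b x s) (b x' s'))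
      \<le> L * D + C" if "hyp_dist (pt x s) (pt x' s') \<le> D" for x s x' s' D
  proof -
    have "L * hyp_dist (pt x s) (pt x' s') \<le> L * D" using that L by (intro mult_left_mono) auto
    then show ?thesis using qi[OF pt_in_H2 pt_in_H2, of x s x' s'] unfolding prod by linarith
  qed
  \<comment> \<open>With equal \<open>b\<close>-values the product distance is the tree distance
    alone, and the lower quasi-isometry bound caps the hyperbolic distance by
    \<open>L * (D + C)\<close>.\<close>
  have sep: "b x s \<noteq> b x' s'"
    if "real (T3_dist (a x s) (a x' s')) \<le> D" "L * (D + C) < hyp_dist (pt x s) (pt x' s')"
    for x s x' s' D
  proof
    assume "b x s = b x' s'"
    then have "hyp_dist (pt x s) (pt x' s') / L \<le> D + C"
      using qi[OF pt_in_H2 pt_in_H2, of x s x' s'] that(1) graph_dist_self[OF bV, of E x s]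
      unfolding prod by simp
    then show False using that(2) L by (simp add: pos_divide_le_eq mult.commute)
  qed
  define \<kappa> where "\<kappa> = 2 * L + C"
  have \<kappa>: "0 \<le> \<kappa>" using L C by (simp add: \<kappa>_def)
  have jump: "real (T3_dist (a x s) (a x' s')) \<le> \<kappa>"
    if "hyp_dist (pt x s) (pt x' s') \<le> 2" for x s x' s'
    using up[OF that] by (simp add: \<kappa>_def)
  \<comment> \<open>\<open>2^c\<close> will be the spacing of the columns in units of the height
    \<open>1 / 2^(2*k)\<close>, wide enough for \<open>sep\<close> with
    \<open>D = 2 * \<kappa>\<close>.\<close>
  obtain c :: nat where c: "L * (2 * \<kappa> + C) + 1/2 < real c" using reals_Archimedean2 by blast
  \<comment> \<open>Chosen so that the row at depth \<open>2 * K * k\<close> separates the blocks by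
    more than \<open>L * (2 * (\<rho> + \<kappa>) + C)\<close>, which is affine in
    \<open>k\<close>.\<close>
  obtain K :: nat where K: "L * (12 * L + 5 * C + 2) + 2 < real K" using reals_Archimedean2 by blast
  have "0 \<le> L * (12 * L + 5 * C + 2)" using L C by simp
  then have K2: "2 \<le> K" using K by linarith
  define v where "v = a 0 0"
  have v: "v \<in> T3_verts" by (simp add: v_def aT)
  obtain N1 :: nat where N1: "L * (2 * real K) \<le> real N1" using real_arch_simple by blast
  obtain N2 :: nat where N2: "real (graph_dist V E z (b 0 0)) + 2 * L + C \<le> real N2"
    using real_arch_simple by blast
  have "2^e \<le> card (graph_ball V E z (N1 * e + (N1 * (c + 1) + N2)))" for e
  proof -
    \<comment> \<open>With this value \<open>2^e\<close> columns of spacing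
      \<open>2^c / 2^(2*k)\<close> fill exactly the width \<open>1 / 2^(k+1)\<close> of half a
      block.\<close>
    define k where "k = e + c + 1"
    define r where "r = N1 * k + N2"
    define S where "S = 2 * K * k"
    have k1: "1 \<le> k" by (simp add: k_def)
    have Sk: "2 * k \<le> S" using K2 by (simp add: S_def)
    have fin: "finite (graph_ball V E z r)" using finite_graph_ball[OF conn deg z] .
    have inball: "b x s \<in> graph_ball V E z r" if "0 \<le> x" "x \<le> 1" "s \<le> S" for x s
    proof -
      have "real (graph_dist V E (b 0 0) (b x s)) \<le> L * (real s + 2) + C"
        using up[OF hyp_dist_pt_base[OF that(1,2)]] by (smt (verit) of_nat_0_le_iff)
      moreover have "real S = 2 * real K * real k" by (simp add: S_def)
      then have "L * real s \<le> L * (2 * real K * real k)"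
        using that(3) L by (intro mult_left_mono) linarith+
      moreover have "L * (2 * real K) * real k \<le> real N1 * real k"
        using N1 by (intro mult_right_mono) auto
      ultimately have "real (graph_dist V E z (b 0 0)) + real (graph_dist V E (b 0 0) (b x s)) \<le> real r"
        using N2 by (simp add: r_def algebra_simps)
      then have "graph_dist V E z (b x s) \<le> r"
        using graph_dist_triangle[OF conn z bV bV, of x s 0 0] by linarith
      then show ?thesis by (simp add: graph_ball_def bV)
    qed
    \<comment> \<open>Points at depth \<open>2 * k\<close> over the unit interval have
      \<open>a\<close>-values within \<open>L * (2 * k + 2) + C\<close> of \<open>v\<close>; the
      extra 1 puts them strictly inside radius \<open>\<rho>\<close>.\<close>
    define \<rho> where "\<rho> = L * (2 * real k + 2) + C + 1"
    \<comment> \<open>Only the left half of each block is used, so that points chosen in different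
      blocks keep a gap of \<open>1 / 2^(k+1)\<close>.\<close>
    have block: "0 \<le> real J / 2^k + t \<and> real J / 2^k + t \<le> 1"
      if "J < 2^k" "0 \<le> t" "t \<le> 1 / 2^(k+1)" for J :: nat and t :: real
    proof -
      have "real J + 1 \<le> 2^k" using that(1)
        by (metis Suc_eq_plus1 Suc_leI of_nat_1 of_nat_add of_nat_le_iff of_nat_numeral of_nat_power)
      moreover have "t * 2^k \<le> 1" using that by (simp add: field_simps)
      ultimately have "real J / 2^k + t \<le> 1" by (simp add: field_simps)
      then show ?thesis using that by simp
    qed
    have "2^e \<le> card (graph_ball V E z r)"
    proof (cases "\<forall>J<2^k. \<exists>t. 0 \<le> t \<and> t \<le> 1 / 2^(k+1) \<and>
          real (T3_dist v (a (real J / 2^k + t) S)) \<le> \<rho> + \<kappa>")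
      case True
      then obtain t where t: "\<And>J. J < 2^k \<Longrightarrow> 0 \<le> t J" "\<And>J. J < 2^k \<Longrightarrow> t J \<le> 1 / 2^(k+1)"
          "\<And>J. J < 2^k \<Longrightarrow> real (T3_dist v (a (real J / 2^k + t J) S)) \<le> \<rho> + \<kappa>" by metis
      define x where "x J = real J / 2^k + t J" for J
      have "b (x I) S \<noteq> b (x J) S" if "I < J" "J < 2^k" for I J
      proof (rule sep)
        have I: "I < 2^k" using that by simp
        note tI = t(1-3)[OF I] and tJ = t(1-3)[OF that(2)]
        have "T3_dist (a (x I) S) (a (x J) S) \<le> T3_dist v (a (x I) S) + T3_dist v (a (x J) S)"
          using T3_dist_triangle[OF aT v aT] T3_dist_commute[OF v aT] by metis
        then have "real (T3_dist (a (x I) S) (a (x J) S)) \<le>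
            real (T3_dist v (a (x I) S)) + real (T3_dist v (a (x J) S))" by linarith
        then show "real (T3_dist (a (x I) S) (a (x J) S)) \<le> 2 * (\<rho> + \<kappa>)"
          using tI(3) tJ(3) unfolding x_def[symmetric] distrib_left by linarith
        have k2: "k + 1 \<le> S" using Sk k1 by linarith
        have "real I + 1 \<le> real J" using that by simp
        then have "(real I + 1) / 2^k \<le> real J / 2^k" by (intro divide_right_mono) auto
        moreover have "1 / 2^(k+1) + 1 / 2^(k+1) = 1 / (2::real)^k" by simp
        ultimately have "1 / 2^(k+1) \<le> x J - x I"
          using tI tJ unfolding x_def add_divide_distrib by linarith
        \<comment> \<open>The gap in units of the row height, as \<open>hyp_dist_pt_lower\<close>
          expects it.\<close>
        moreover have "2^(S - (k+1)) / 2^S = 1 / (2::real)^(k+1)"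
          using k2 by (simp add: power_diff)
        ultimately have "2^(S - (k+1)) / 2^S \<le> \<bar>x I - x J\<bar>" by linarith
        then have h: "real (S - (k+1)) - 1/2 \<le> hyp_dist (pt (x I) S) (pt (x J) S)"
          by (intro hyp_dist_pt_lower) auto
        have "L * (2 * (\<rho> + \<kappa>) + C) = L * (4 * L) * real k + L * (8 * L + 5 * C + 2)"
          by (simp add: \<rho>_def \<kappa>_def algebra_simps)
        also have "\<dots> \<le> L * (4 * L) * real k + L * (8 * L + 5 * C + 2) * real k"
          using mult_left_mono[of 1 "real k" "L * (8 * L + 5 * C + 2)"] L C k1 by simp
        also have "\<dots> = L * (12 * L + 5 * C + 2) * real k" by (simp add: algebra_simps)
        also have "\<dots> < (real K - 2) * real k" using K k1 by (intro mult_strict_right_mono) auto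
        also have "\<dots> \<le> real (S - (k+1)) - 1/2"
        proof -
          have "real (S - (k+1)) = 2 * (real K * real k) - real k - 1"
            using k2 by (simp add: of_nat_diff S_def)
          moreover have "0 \<le> real K * real k" by simp
          ultimately show ?thesis using k1 by (simp add: algebra_simps)
        qed
        finally show "L * (2 * (\<rho> + \<kappa>) + C) < hyp_dist (pt (x I) S) (pt (x J) S)" using h by linarith
      qed
      then have "inj_on (\<lambda>J. b (x J) S) {..<2^k}" by (intro linorder_inj_onI) auto
      moreover have "(\<lambda>J. b (x J) S) ` {..<2^k} \<subseteq> graph_ball V E z r"
        using inball block t unfolding x_def by blast
      ultimately have "2^k \<le> card (graph_ball V E z r)" using fin by (rule card_ge_pow2)
      moreover have "(2::nat)^e \<le> 2^k" by (intro power_increasing) (auto simp: k_def)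
      ultimately show ?thesis by linarith
    next
      case False
      then obtain J where J: "J < 2^k" and far: "\<And>t. 0 \<le> t \<Longrightarrow> t \<le> 1 / 2^(k+1) \<Longrightarrow>
          \<rho> + \<kappa> < real (T3_dist v (a (real J / 2^k + t) S))" by (meson linorder_not_le)
      define x where "x t = real J / 2^k + t" for t
      \<comment> \<open>Steps of one row height \<open>1 / 2^S\<close>, so consecutive
        \<open>a\<close>-values differ by at most \<open>\<kappa>\<close>. The left end
        \<open>q 0\<close> is the common reference point for all columns.\<close>
      define q where "q i = a (x (real i / 2^S)) S" for i :: nat
      define t where "t j = real j * (2^c / 2^(2*k))" for j :: nat
      have tmax: "t j \<le> 1 / 2^(k+1)" if "j < 2^e" for j
      proof -
        have "real j \<le> 2^e" using that by (metis less_imp_le of_nat_le_iff of_nat_numeral of_nat_power)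
        then have "t j \<le> 2^e * (2^c / 2^(2*k))" unfolding t_def by (intro mult_right_mono) auto
        also have "2^e * (2^c / 2^(2*k)) = 1 / (2::real)^(k+1)"
        proof -
          have "2 * k = e + c + (k + 1)" by (simp add: k_def)
          then show ?thesis by (simp only: power_add) simp
        qed
        finally show ?thesis .
      qed
      have t0: "0 \<le> t j" for j by (simp add: t_def)
      have "\<exists>s. 2*k \<le> s \<and> s \<le> S \<and> real (T3_dist v (a (x (t j)) s)) \<le> \<rho> + \<kappa> \<and>
          \<rho> \<le> gromov v (a (x (t j)) s) (q 0)" if j: "j < 2^e" for j
      proof -
        \<comment> \<open>The index at which the row meets column \<open>j\<close>.\<close>
        define n where "n = j * 2^c * 2^(S - 2*k)"
        have "(2::real)^S = 2^(S - 2*k) * 2^(2*k)" using Sk by (simp flip: power_add)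
        then have tn: "real n / 2^S = t j" by (simp add: n_def t_def)
        have "\<rho> \<le> gromov v (q 0) (q n)"
        proof (rule gromov_chain[OF v])
          fix i
          show "q i \<in> T3_verts" by (simp add: q_def aT)
          assume "i \<le> n"
          then have "real i / 2^S \<le> t j" unfolding tn[symmetric] by (intro divide_right_mono) auto
          then show "\<rho> + \<kappa> \<le> real (T3_dist v (q i))"
            using far[of "real i / 2^S"] tmax[OF j] unfolding q_def x_def by simp
        next
          fix i
          have "\<bar>x (real i / 2^S) - x (real (Suc i) / 2^S)\<bar> \<le> 1 / 2^S"
            by (simp add: x_def field_simps)
          then show "real (T3_dist (q i) (q (Suc i))) \<le> \<kappa>"
            unfolding q_def by (intro jump hyp_dist_pt_side)
        qed (rule \<kappa>)
        then have qn: "\<rho> \<le> gromov v (q n) (q 0)" using gromov_commute by (simp add: q_def aT)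
        \<comment> \<open>Column \<open>j\<close> read downwards: it starts at depth
          \<open>2 * k\<close>, where \<open>a\<close> is close to \<open>v\<close>, and ends on the
          row at \<open>q n\<close>.\<close>
        define p where "p i = a (x (t j)) (2 * k + i)" for i
        have pT: "p i \<in> T3_verts" for i by (simp add: p_def aT)
        have qT: "q i \<in> T3_verts" for i by (simp add: q_def aT)
        have pq: "p (S - 2*k) = q n" using Sk by (simp add: p_def q_def tn)
        obtain i where i: "i \<le> S - 2*k" "real (T3_dist v (p i)) \<le> \<rho> + \<kappa>" "\<rho> \<le> gromov v (p i) (q n)"
        proof (rule gromov_crossing[OF v qT pT])
          show "real (T3_dist (p i) (p (Suc i))) \<le> \<kappa>" for i
            using jump[OF hyp_dist_pt_down] by (simp add: p_def)
          have "real (T3_dist v (p 0)) \<le> L * (real (2 * k) + 2) + C"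
            using up[OF hyp_dist_pt_base, of "x (t j)" "2*k"] block[OF J t0 tmax[OF j]]
            unfolding v_def p_def x_def by (smt (verit) add.right_neutral of_nat_0_le_iff)
          then show "gromov v (p 0) (q n) < \<rho>"
            using gromov_le[OF v pT qT, of 0 n] by (simp add: \<rho>_def)
          show "\<rho> \<le> gromov v (p (S - 2*k)) (q n)"
            unfolding pq gromov_self[OF qT] using far[OF t0 tmax[OF j]] \<kappa> tn
            by (simp add: q_def x_def)
        qed
        \<comment> \<open>The row links \<open>q n\<close> to \<open>q 0\<close>, so every column is
          seen to enter the same branch.\<close>
        have "\<rho> \<le> gromov v (p i) (q 0)"
          using gromov_ultrametric[OF v pT qT qT, of i n 0] i(3) qn by linarith
        then show ?thesis using i Sk unfolding p_def by (intro exI[of _ "2*k + i"]) auto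
      qed
      then obtain s where s: "\<And>j. j < 2^e \<Longrightarrow> 2*k \<le> s j" "\<And>j. j < 2^e \<Longrightarrow> s j \<le> S"
          "\<And>j. j < 2^e \<Longrightarrow> real (T3_dist v (a (x (t j)) (s j))) \<le> \<rho> + \<kappa>"
          "\<And>j. j < 2^e \<Longrightarrow> \<rho> \<le> gromov v (a (x (t j)) (s j)) (q 0)" by metis
      have "b (x (t i)) (s i) \<noteq> b (x (t j)) (s j)" if "i < j" "j < 2^e" for i j
      proof (rule sep)
        have i: "i < 2^e" using that by simp
        have "gromov v (q 0) (a (x (t j)) (s j)) = gromov v (a (x (t j)) (s j)) (q 0)"
          by (intro gromov_commute) (simp_all add: q_def aT)
        then have "\<rho> \<le> gromov v (a (x (t i)) (s i)) (a (x (t j)) (s j))"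
          using gromov_ultrametric[OF v aT _ aT, of "q 0" "x (t i)" "s i" "x (t j)" "s j"]
            s[OF i] s[OF that(2)] by (simp add: q_def aT)
        then show "real (T3_dist (a (x (t i)) (s i)) (a (x (t j)) (s j))) \<le> 2 * \<kappa>"
          using s[OF i] s[OF that(2)] by (intro T3_dist_le_of_gromov) auto
        \<comment> \<open>The crossing depths may differ between columns, but all are at least
          \<open>2 * k\<close>, so the horizontal gap alone forces hyperbolic distance at least
          \<open>c - 1/2\<close>.\<close>
        have "1 * (2^c / 2^(2*k)) \<le> (real j - real i) * (2^c / 2^(2*k))"
          using that by (intro mult_right_mono) auto
        then have "2^c / 2^(2*k) \<le> \<bar>x (t i) - x (t j)\<bar>"
          unfolding x_def t_def left_diff_distrib by linarith
        then have "real c - 1/2 \<le> hyp_dist (pt (x (t i)) (s i)) (pt (x (t j)) (s j))"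
          using s[OF i] s[OF that(2)] by (intro hyp_dist_pt_lower) auto
        then show "L * (2 * \<kappa> + C) < hyp_dist (pt (x (t i)) (s i)) (pt (x (t j)) (s j))"
          using c by linarith
      qed
      then have "inj_on (\<lambda>j. b (x (t j)) (s j)) {..<2^e}" by (intro linorder_inj_onI) auto
      moreover have "(\<lambda>j. b (x (t j)) (s j)) ` {..<2^e} \<subseteq> graph_ball V E z r"
        using inball block[OF J t0 tmax] s unfolding x_def by blast
      ultimately show ?thesis using fin by (rule card_ge_pow2)
    qed
    then show ?thesis by (simp add: r_def k_def algebra_simps)
  qed
  moreover have "0 < N1"
  proof (rule ccontr)
    assume "\<not> 0 < N1"
    moreover have "0 < L * (2 * real K)" using L K2 by simp
    ultimately show False using N1 by simp
  qed
  ultimately show ?thesis by blast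
qed

section \<open>Exponential against subexponential growth\<close>

text \<open>Along \<open>r = M * e + N\<close> the quotient is at least \<open>e * ln 2 / r\<close>,
  which is bounded below by \<open>ln 2 / (M + 1)\<close> once \<open>e\<close> is at least
  \<open>N\<close>.\<close>

lemma exponential_growth_not_limit_0:
  fixes g :: "nat \<Rightarrow> nat"
  assumes "0 < M" and g: "\<And>e. 2^e \<le> g (M * e + N)"
  shows "\<not> (\<lambda>r. ln (real (g r)) / real r) \<longlonglongrightarrow> 0"
proof
  assume lim: "(\<lambda>r. ln (real (g r)) / real r) \<longlonglongrightarrow> 0"
  define \<epsilon> :: real where "\<epsilon> = ln 2 / (real M + 1)"
  have "0 < \<epsilon>" by (simp add: \<epsilon>_def)
  then obtain R where R: "\<And>r. R \<le> r \<Longrightarrow> \<bar>ln (real (g r)) / real r\<bar> < \<epsilon>"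
    using LIMSEQ_D[OF lim] by auto
  \<comment> \<open>Large enough to give both \<open>R \<le> r\<close> and
    \<open>r \<le> (M + 1) * e\<close>.\<close>
  define e where "e = R + N + 1"
  define r where "r = M * e + N"
  have "e \<le> M * e" using \<open>0 < M\<close> by simp
  then have r: "R \<le> r" "0 < r" unfolding r_def e_def by linarith+
  have "real (2^e) \<le> real (g r)" unfolding r_def by (rule of_nat_mono[OF g])
  then have "ln (2^e) \<le> ln (real (g r))" by (subst ln_le_cancel_iff) (auto intro: less_le_trans[of _ "2^e"])
  moreover have "ln (2^e) = real e * ln (2::real)" by (simp add: ln_realpow)
  moreover have "ln (real (g r)) < \<epsilon> * real r" using R[OF r(1)] r(2) by (simp add: pos_divide_less_eq abs_less_iff)
  moreover have "\<epsilon> * real r \<le> real e * ln 2"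
  proof -
    have "real r \<le> (real M + 1) * real e" by (simp add: r_def e_def algebra_simps)
    then have "\<epsilon> * real r \<le> \<epsilon> * ((real M + 1) * real e)" using \<open>0 < \<epsilon>\<close> by (intro mult_left_mono) auto
    also have "\<dots> = real e * ln 2" by (simp add: \<epsilon>_def)
    finally show ?thesis .
  qed
  ultimately show False by linarith
qed

theorem theoremB:
  fixes V :: "'z set" and E :: "'z \<Rightarrow> 'z \<Rightarrow> bool"
  assumes "simple_graph V E" and "V \<noteq> {}" and "connected_graph V E"
    and "bounded_degree V E" and "subexp_growth V E"
  shows "\<not> (\<exists>f :: complex \<Rightarrow> nat list \<times> 'z.
            qi_embedding H2 hyp_dist (T3_verts \<times> V) (T3_prod_dist V E) f)"
proof
  assume "\<exists>f :: complex \<Rightarrow> nat list \<times> 'z.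
    qi_embedding H2 hyp_dist (T3_verts \<times> V) (T3_prod_dist V E) f"
  moreover obtain z where "z \<in> V"
    and lim: "(\<lambda>r. ln (real (card (graph_ball V E z r))) / real r) \<longlonglongrightarrow> 0"
    using assms(5) unfolding subexp_growth_def by blast
  ultimately obtain M N where "0 < M" "\<And>e. 2^e \<le> card (graph_ball V E z (M * e + N))"
    using qi_embedding_exponential_growth[OF assms(3,4)] by metis
  from exponential_growth_not_limit_0[OF this] show False using lim by blast
qed

end
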